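(* Let $q$ be a non-zero real number. There exist infinitely many trees with potential at exactly two vertices that admit perfect pair state transfer relative to the $q$-Laplacian matrix.
   Context: Trees here are finite and unweighted. A potential is a real function $\eta$ on the vertices; "potential at exactly two vertices" means $\eta$ is non-zero at exactly two vertices. With adjacency matrix $A$, diagonal degree matrix $\Delta$ and diagonal matrix $\Delta'$ with $\Delta'_{vv}=\eta(v)$, the $q$-Laplacian matrix is $\mathscr{L}=(1-q^2)I+q^2(\Delta+\Delta')-qA$. A pair state is a vector $\frac{1}{\sqrt2}(\mathbf{e}_a-\mathbf{e}_b)$ with $a\ne b$ vertices, where $\mathbf{e}_a$ is the characteristic vector of $a$. Perfect pair state transfer means there are two linearly independent pair states $\mathbf{x},\mathbf{y}$, some $\tau>0$ and $\gamma\in\mathbb{C}$ with $\exp(i\tau\mathscr{L})\mathbf{x}=\gamma\mathbf{y}$. *)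

theory Defs
  imports
    Complex_Main
    "Graph_Theory.Digraph_Isomorphism"
    "Jordan_Normal_Form.VS_Connect"
    "Jordan_Normal_Form.Spectral_Radius"
begin

text \<open>
  A finite simple undirected graph is a symmetric loop-free digraph (\<^locale>\<open>pair_graph\<close>) whose
  arcs are the two orientations of each edge. The constant \<^const>\<open>Digraph_Component.tree\<close>
  cannot be used for such graphs: it excludes all directed cycles, hence also the closed walk
  $u, v, u$ along a single edge. The cycles of the underlying undirected graph are those of
  length at least 3. Vertices are $0, \dots, n-1$, so that they index the rows and columns of
  matrices; every finite tree is isomorphic to one of this form.
\<close>

definition tree_on :: "nat \<Rightarrow> nat pair_pre_digraph \<Rightarrow> bool" where
  "tree_on n T \<longleftrightarrow> pair_graph T \<and> pverts T = {..<n} \<and>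
     Digraph_Component.connected (with_proj T) \<and>
     \<not> (\<exists>p. pre_digraph.cycle (with_proj T) p \<and> length p \<ge> 3)"

definition adjacency_mat :: "nat \<Rightarrow> nat pair_pre_digraph \<Rightarrow> real mat" where
  "adjacency_mat n G = mat n n (\<lambda>(u, v). if (u, v) \<in> parcs G then 1 else 0)"

text \<open>In a symmetric digraph the out-degree is the degree of the undirected graph.\<close>

definition degree_mat :: "nat \<Rightarrow> nat pair_pre_digraph \<Rightarrow> real mat" where
  "degree_mat n G =
     mat n n (\<lambda>(u, v). if u = v then real (out_degree (with_proj G) u) else 0)"

definition potential_mat :: "nat \<Rightarrow> (nat \<Rightarrow> real) \<Rightarrow> real mat" where
  "potential_mat n \<eta> = mat n n (\<lambda>(u, v). if u = v then \<eta> u else 0)"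

definition q_laplacian ::
    "real \<Rightarrow> nat \<Rightarrow> nat pair_pre_digraph \<Rightarrow> (nat \<Rightarrow> real) \<Rightarrow> real mat" where
  "q_laplacian q n G \<eta> =
     (1 - q\<^sup>2) \<cdot>\<^sub>m 1\<^sub>m n + q\<^sup>2 \<cdot>\<^sub>m (degree_mat n G + potential_mat n \<eta>)
       - q \<cdot>\<^sub>m adjacency_mat n G"

text \<open>
  The exponential of a square matrix, as the entrywise sum of the power series (which always
  converges, see \<open>summable_mat_exp\<close> below).
\<close>

definition mat_exp :: "complex mat \<Rightarrow> complex mat" where
  "mat_exp A = mat (dim_row A) (dim_row A) (\<lambda>(i, j). \<Sum>k. (A ^\<^sub>m k) $$ (i, j) / fact k)"

lemma norm_pow_mat_le:
  fixes A :: "complex mat"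
  assumes A: "A \<in> carrier_mat n n"
    and b: "\<And>i j. i < n \<Longrightarrow> j < n \<Longrightarrow> norm (A $$ (i, j)) \<le> b"
    and b0: "b \<ge> 0" and ij: "i < n" "j < n"
  shows "norm ((A ^\<^sub>m k) $$ (i, j)) \<le> (real n * b) ^ k"
  using ij
proof (induction k arbitrary: i j)
  case 0
  then show ?case using A by simp
next
  case (Suc k)
  have "(A ^\<^sub>m Suc k) $$ (i, j) = (\<Sum>l\<in>{0..<n}. (A ^\<^sub>m k) $$ (i, l) * A $$ (l, j))"
    using A Suc.prems pow_carrier_mat[OF A, of k] by (simp add: scalar_prod_def)
  also have "norm \<dots> \<le> (\<Sum>l\<in>{0..<n}. (real n * b) ^ k * b)"
    by (rule order.trans[OF norm_sum], rule sum_mono)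
       (use Suc b b0 in \<open>auto simp: norm_mult intro!: mult_mono\<close>)
  also have "\<dots> = (real n * b) ^ Suc k"
    by simp
  finally show ?case .
qed

lemma summable_mat_exp:
  fixes A :: "complex mat"
  assumes A: "A \<in> carrier_mat n n" and ij: "i < n" "j < n"
  shows "summable (\<lambda>k. (A ^\<^sub>m k) $$ (i, j) / fact k)"
proof -
  define b where "b = (\<Sum>(i, j)\<in>{..<n} \<times> {..<n}. norm (A $$ (i, j)))"
  have "norm (A $$ (i, j)) \<le> b" if "i < n" "j < n" for i j
    using member_le_sum[of "(i, j)" "{..<n} \<times> {..<n}" "\<lambda>(i, j). norm (A $$ (i, j))"] that
    by (auto simp: b_def)
  moreover have "b \<ge> 0"
    unfolding b_def by (auto intro: sum_nonneg)
  ultimately have "norm ((A ^\<^sub>m k) $$ (i, j)) \<le> (real n * b) ^ k" for k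
    using norm_pow_mat_le[OF A] ij by blast
  then have "norm ((A ^\<^sub>m k) $$ (i, j) / fact k) \<le> (real n * b) ^ k / fact k" for k
    by (simp add: norm_divide divide_right_mono)
  moreover have "summable (\<lambda>k. (real n * b) ^ k / fact k)"
    using summable_exp[of "real n * b"] by (simp add: field_simps)
  ultimately show ?thesis
    by (auto intro: summable_comparison_test')
qed

definition pair_state :: "nat \<Rightarrow> complex vec \<Rightarrow> bool" where
  "pair_state n x \<longleftrightarrow>
     (\<exists>a<n. \<exists>b<n. a \<noteq> b \<and> x = complex_of_real (1 / sqrt 2) \<cdot>\<^sub>v (unit_vec n a - unit_vec n b))"

text \<open>
  Linear dependence is a property of sets, so \<open>x \<noteq> y\<close> is needed to make the pair \<open>x\<close>, \<open>y\<close>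
  linearly independent.
\<close>

definition perfect_pair_state_transfer :: "nat \<Rightarrow> real mat \<Rightarrow> bool" where
  "perfect_pair_state_transfer n L \<longleftrightarrow>
     (\<exists>x y. pair_state n x \<and> pair_state n y \<and>
        x \<noteq> y \<and> \<not> module.lin_dep class_ring (module_vec TYPE(complex) n) {x, y} \<and>
        (\<exists>\<tau>::real. \<exists>\<gamma>::complex. \<tau> > 0 \<and>
           mat_exp ((\<i> * complex_of_real \<tau>) \<cdot>\<^sub>m map_mat complex_of_real L) *\<^sub>v x = \<gamma> \<cdot>\<^sub>v y))"

end

theory Submission
  imports Defs
begin

text \<open>
  Two isomorphic legs $c, u_1, u_3$ and $c, u_2, u_4$ hang from a common vertex $c$ of a tree. On
  vectors that are antisymmetric under exchanging the legs the rest of the tree is invisible: the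
  contributions of the two legs cancel at $c$. Hence the pair vectors
  $x = \mathbf{e}_{u_1} - \mathbf{e}_{u_2}$ and $y = \mathbf{e}_{u_3} - \mathbf{e}_{u_4}$ span a
  plane invariant under the $q$-Laplacian. The inner vertices $u_1, u_2$ have degree 2 and the feet
  $u_3, u_4$ have degree 1; the potential 1 on exactly the two feet makes up for this
  difference, so that the $q$-Laplacian acts on the basis $x, y$ by the matrix with diagonal
  entries $1 + q^2$ and off-diagonal entries $-q$
  (\<open>perfect_pair_state_transfer_two_legged_star\<close>).

  Such a matrix has the eigenvectors $x + y$ and $x - y$, so the exponential is explicit
  (\<open>mat_exp_mult_swapped_pair\<close>): up to a common phase, $x$ evolves to
  $\cos(q\tau) x - i \sin(q\tau) y$. At $\tau = \pi / (2 |q|)$ the first term vanishes and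
  the transfer is perfect (\<open>perfect_pair_state_transferI\<close>).

  Since the argument leaves the rest of the tree free, attaching further leaves to $c$ gives a tree
  on $n$ vertices for every $n \ge 5$. Trees of different sizes are not isomorphic.
\<close>

section \<open>Trees from parent functions\<close>

text \<open>
  The vertex 0 is the root. The condition \<open>p v < v\<close> for non-root vertices, assumed in the
  lemmas below, makes \<open>p\<close> the parent function of a rooted tree numbered from the root outwards.
\<close>

definition parent_tree :: "nat \<Rightarrow> (nat \<Rightarrow> nat) \<Rightarrow> nat pair_pre_digraph" where
  "parent_tree n p =
     \<lparr>pverts = {..<n},
      parcs = {(u, v). u < n \<and> v < n \<and> (0 < u \<and> v = p u \<or> 0 < v \<and> u = p v)}\<rparr>"

lemma pverts_parent_tree [simp]: "pverts (parent_tree n p) = {..<n}"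
  by (simp add: parent_tree_def)

lemma in_parcs_parent_tree [simp]:
  "(u, v) \<in> parcs (parent_tree n p) \<longleftrightarrow> u < n \<and> v < n \<and> (0 < u \<and> v = p u \<or> 0 < v \<and> u = p v)"
  by (simp add: parent_tree_def)

lemma fst_nth_pcas:
  "pcas u p v \<Longrightarrow> i < length p \<Longrightarrow> fst (p ! i) = (if i = 0 then u else snd (p ! (i - 1)))"
proof (induction p arbitrary: u i)
  case (Cons e p)
  then show ?case
    by (cases i) (auto simp: nth_Cons split: nat.splits)
qed simp

lemma snd_last_pcas: "pcas u p v \<Longrightarrow> p \<noteq> [] \<Longrightarrow> snd (last p) = v"
  by (induction p arbitrary: u) auto

lemma pair_graph_parent_tree:
  assumes less: "\<And>v. 0 < v \<Longrightarrow> v < n \<Longrightarrow> p v < v"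
  shows "pair_graph (parent_tree n p)"
proof unfold_locales
  show "finite (parcs (parent_tree n p))"
    by (rule finite_subset[of _ "{..<n} \<times> {..<n}"]) (auto simp: parent_tree_def)
  show "symmetric (with_proj (parent_tree n p))"
    by (auto simp: symmetric_def sym_def)
  show "fst e \<noteq> snd e" if "e \<in> parcs (parent_tree n p)" for e
    using that less[of "fst e"] less[of "snd e"] by (cases e) auto
qed (auto simp: parent_tree_def)

lemma connected_parent_tree:
  assumes n: "n > 0" and less: "\<And>v. 0 < v \<Longrightarrow> v < n \<Longrightarrow> p v < v"
  shows "Digraph_Component.connected (with_proj (parent_tree n p))"
proof -
  interpret pair_graph "parent_tree n p"
    by (rule pair_graph_parent_tree) (fact less)
  let ?G = "with_proj (parent_tree n p)"
  have to_root: "v \<rightarrow>\<^sup>*\<^bsub>?G\<^esub> 0" if "v < n" for v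
    using that
  proof (induction v rule: less_induct)
    case (less v)
    show ?case
    proof (cases "v = 0")
      case True
      then show ?thesis using less.prems by auto
    next
      case False
      then have "p v < v" using assms(2) less.prems by simp
      moreover have "(v, p v) \<in> parcs (parent_tree n p)"
        using False \<open>p v < v\<close> less.prems by simp
      ultimately show ?thesis
        using less.IH[of "p v"] less.prems
        by (intro adj_reachable_trans[of v "p v" 0]) auto
    qed
  qed
  have "u \<rightarrow>\<^sup>*\<^bsub>?G\<^esub> v" if "u < n" "v < n" for u v
    using to_root[OF that(1)] symmetric_reachable'[OF to_root[OF that(2)]]
    by (rule reachable_trans)
  then have "u \<rightarrow>\<^sup>*\<^bsub>mk_symmetric ?G\<^esub> v" if "u < n" "v < n" for u v
    using reachable_mk_symmetricI that by blast
  then show ?thesis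
    using n by (auto simp: connected_def strongly_connected_def)
qed

text \<open>
  The largest vertex of a cycle is adjacent only to smaller vertices of the cycle, and the only
  smaller neighbour of a vertex is its parent. So its predecessor and its successor on the cycle
  coincide, which happens only if the cycle runs back and forth along one edge.
\<close>

lemma no_long_cycle_parent_tree:
  assumes less: "\<And>v. 0 < v \<Longrightarrow> v < n \<Longrightarrow> p v < v"
  assumes cyc: "pre_digraph.cycle (with_proj (parent_tree n p)) c"
  shows "length c \<le> 2"
proof (rule ccontr)
  assume long: "\<not> length c \<le> 2"
  define k where "k = length c"
  have k: "k \<ge> 3" using long by (simp add: k_def)
  interpret pair_graph "parent_tree n p"
    by (rule pair_graph_parent_tree) (fact less)
  obtain u where arcs: "set c \<subseteq> parcs (parent_tree n p)" and cas: "pcas u c u"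
    and dist: "distinct (tl (pawalk_verts u c))"
    using cyc unfolding cycle_def awalk_def by blast
  have "c \<noteq> []" using k by (auto simp: k_def)
  have "pawalk_verts u c = fst (hd c) # map snd c"
    using awalk_verts_conv'[OF cas] \<open>c \<noteq> []\<close> by simp
  then have dist: "distinct (map snd c)"
    using dist by simp
  \<comment> \<open>The vertices of the cycle as a sequence of period \<open>k\<close>, to avoid separate cases for a
      maximum at either end of the list \<open>c\<close>.\<close>
  define w where "w j = snd (c ! (j mod k))" for j
  have w_inj: "i mod k = j mod k" if "w i = w j" for i j
  proof -
    have "i mod k < length c" "j mod k < length c" using k by (simp_all add: \<open>c \<noteq> []\<close> k_def)
    then show ?thesis
      using that dist nth_eq_iff_index_eq[of "map snd c" "i mod k" "j mod k"] by (simp add: w_def)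
  qed
  have step: "(w j, w (Suc j)) \<in> parcs (parent_tree n p)" for j
  proof -
    have lt: "Suc j mod k < length c" using k by (simp add: \<open>c \<noteq> []\<close> k_def)
    have "fst (c ! (Suc j mod k)) = w j"
    proof (cases "Suc j mod k = 0")
      case True
      then have "j mod k = k - 1"
        using k by (auto simp: mod_Suc split: if_splits)
      then show ?thesis
        using True fst_nth_pcas[OF cas lt] snd_last_pcas[OF cas] \<open>c \<noteq> []\<close>
        by (simp add: w_def last_conv_nth k_def)
    next
      case False
      then show ?thesis
        using fst_nth_pcas[OF cas lt] by (auto simp: w_def mod_Suc)
    qed
    moreover have "c ! (Suc j mod k) \<in> parcs (parent_tree n p)"
      using lt arcs nth_mem by blast
    ultimately show ?thesis by (simp add: w_def prod_eq_iff) (metis prod.collapse in_parcs_parent_tree)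
  qed
  obtain i where i: "i < k" "\<And>j. j < k \<Longrightarrow> w j \<le> w i"
  proof -
    have "w 0 \<in> w ` {..<k}" using k by simp
    then have "Max (w ` {..<k}) \<in> w ` {..<k}"
      by (intro Max_in) auto
    then obtain i where "i < k" "Max (w ` {..<k}) = w i" by auto
    then show ?thesis
      using that[of i] Max_ge[of "w ` {..<k}"] by auto
  qed
  have max: "w j \<le> w i" for j
    using i(2)[of "j mod k"] k by (simp add: w_def)
  \<comment> \<open>The position before \<open>i\<close>, one period later so that the subtraction does not truncate.\<close>
  define j where "j = i + k - 1"
  have wj: "w (Suc j) = w i" using k by (simp add: j_def w_def)
  have nbr: "v = p (w i)" if "(v, w i) \<in> parcs (parent_tree n p)" "v \<le> w i" for v
    using that less[of v] by auto
  have "w j = p (w i)"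
    using step[of j] max[of j] wj by (intro nbr) auto
  moreover have "w (Suc (Suc j)) = p (w i)"
    using step[of "Suc j"] max[of "Suc (Suc j)"] wj by (intro nbr) auto
  ultimately have "j mod k = (j + 2) mod k"
    using w_inj[of j "Suc (Suc j)"] by simp
  then have "k dvd 2"
    by (metis add_diff_cancel_left' le_add1 mod_eq_dvd_iff_nat)
  then show False
    using k by (auto dest: dvd_imp_le)
qed

lemma tree_on_parent_tree:
  assumes "n > 0" and "\<And>v. 0 < v \<Longrightarrow> v < n \<Longrightarrow> p v < v"
  shows "tree_on n (parent_tree n p)"
proof -
  have "\<not> (pre_digraph.cycle (with_proj (parent_tree n p)) c \<and> length c \<ge> 3)" for c
    using no_long_cycle_parent_tree[of n p c, OF assms(2)] by auto
  then show ?thesis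
    unfolding tree_on_def
    using pair_graph_parent_tree[of n p] connected_parent_tree[of n p] assms by simp
qed

section \<open>The matrix exponential on an invariant plane\<close>

lemma pow_mat_mult_eigenvector:
  fixes A :: "complex mat"
  assumes A: "A \<in> carrier_mat n n" and v: "v \<in> carrier_vec n" and ev: "A *\<^sub>v v = \<mu> \<cdot>\<^sub>v v"
  shows "(A ^\<^sub>m k) *\<^sub>v v = \<mu> ^ k \<cdot>\<^sub>v v"
proof (induction k)
  case 0
  then show ?case using A v by simp
next
  case (Suc k)
  have "(A ^\<^sub>m Suc k) *\<^sub>v v = (A ^\<^sub>m k) *\<^sub>v (A *\<^sub>v v)"
    using A v by (simp add: assoc_mult_mat_vec[of _ n n _ n])
  also have "\<dots> = \<mu> \<cdot>\<^sub>v ((A ^\<^sub>m k) *\<^sub>v v)"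
    unfolding ev using A v by (intro mult_mat_vec) auto
  finally show ?case
    by (simp add: Suc smult_smult_assoc)
qed

lemma mat_exp_carrier [simp]: "A \<in> carrier_mat n n \<Longrightarrow> mat_exp A \<in> carrier_mat n n"
  by (simp add: mat_exp_def)

lemma mat_exp_mult_eigenvector:
  fixes A :: "complex mat"
  assumes A: "A \<in> carrier_mat n n" and v: "v \<in> carrier_vec n" and ev: "A *\<^sub>v v = \<mu> \<cdot>\<^sub>v v"
  shows "mat_exp A *\<^sub>v v = exp \<mu> \<cdot>\<^sub>v v"
proof (rule eq_vecI)
  fix i assume "i < dim_vec (exp \<mu> \<cdot>\<^sub>v v)"
  then have i: "i < n" using v by simp
  have pow: "(\<Sum>j\<in>{0..<n}. (A ^\<^sub>m k) $$ (i, j) * v $ j) = \<mu> ^ k * v $ i" for k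
  proof -
    have "((A ^\<^sub>m k) *\<^sub>v v) $ i = (\<Sum>j\<in>{0..<n}. (A ^\<^sub>m k) $$ (i, j) * v $ j)"
      using i v A pow_carrier_mat[OF A, of k] by (simp add: scalar_prod_def)
    then show ?thesis
      using i v by (simp add: pow_mat_mult_eigenvector[OF A v ev])
  qed
  have "(mat_exp A *\<^sub>v v) $ i
      = (\<Sum>j\<in>{0..<n}. (\<Sum>k. (A ^\<^sub>m k) $$ (i, j) / fact k) * v $ j)"
    using i v A by (simp add: mat_exp_def scalar_prod_def)
  also have "\<dots> = (\<Sum>j\<in>{0..<n}. \<Sum>k. (A ^\<^sub>m k) $$ (i, j) / fact k * v $ j)"
    using i by (intro sum.cong suminf_mult2 summable_mat_exp[OF A]) auto
  also have "\<dots> = (\<Sum>k. \<Sum>j\<in>{0..<n}. (A ^\<^sub>m k) $$ (i, j) / fact k * v $ j)"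
    using i by (intro suminf_sum[symmetric] summable_mult2 summable_mat_exp[OF A]) auto
  also have "\<dots> = (\<Sum>k. \<mu> ^ k /\<^sub>R fact k * v $ i)"
  proof (rule suminf_cong)
    fix k
    have "(\<Sum>j\<in>{0..<n}. (A ^\<^sub>m k) $$ (i, j) / fact k * v $ j)
        = (\<Sum>j\<in>{0..<n}. (A ^\<^sub>m k) $$ (i, j) * v $ j) / fact k"
      by (simp add: sum_divide_distrib)
    then show "(\<Sum>j\<in>{0..<n}. (A ^\<^sub>m k) $$ (i, j) / fact k * v $ j) = \<mu> ^ k /\<^sub>R fact k * v $ i"
      unfolding pow by (simp add: scaleR_conv_of_real divide_inverse mult_ac)
  qed
  also have "\<dots> = exp \<mu> * v $ i"
    by (simp add: exp_def suminf_mult2[OF summable_exp_generic])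
  finally show "(mat_exp A *\<^sub>v v) $ i = (exp \<mu> \<cdot>\<^sub>v v) $ i"
    using i v by simp
qed (use A v in \<open>auto simp: mat_exp_def\<close>)

text \<open>
  The plane spanned by \<open>x\<close> and \<open>y\<close> is diagonalised by \<open>x + y\<close> and \<open>x - y\<close>, with eigenvalues
  $\alpha + \beta$ and $\alpha - \beta$; the result is the mean of the two evolutions.
\<close>

lemma mat_exp_mult_swapped_pair:
  fixes A :: "complex mat"
  assumes A: "A \<in> carrier_mat n n" and x: "x \<in> carrier_vec n" and y: "y \<in> carrier_vec n"
    and Ax: "A *\<^sub>v x = \<alpha> \<cdot>\<^sub>v x + \<beta> \<cdot>\<^sub>v y" and Ay: "A *\<^sub>v y = \<alpha> \<cdot>\<^sub>v y + \<beta> \<cdot>\<^sub>v x"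
  shows "mat_exp A *\<^sub>v x = exp \<alpha> \<cdot>\<^sub>v (cosh \<beta> \<cdot>\<^sub>v x + sinh \<beta> \<cdot>\<^sub>v y)"
proof -
  have sum: "mat_exp A *\<^sub>v (x + y) = exp (\<alpha> + \<beta>) \<cdot>\<^sub>v (x + y)"
  proof (rule mat_exp_mult_eigenvector[OF A])
    have "A *\<^sub>v (x + y) = A *\<^sub>v x + A *\<^sub>v y"
      using A x y by (rule mult_add_distrib_mat_vec)
    then show "A *\<^sub>v (x + y) = (\<alpha> + \<beta>) \<cdot>\<^sub>v (x + y)"
      unfolding Ax Ay using x y by (intro eq_vecI) (auto simp: algebra_simps)
  qed (use x y in auto)
  have diff: "mat_exp A *\<^sub>v (x - y) = exp (\<alpha> - \<beta>) \<cdot>\<^sub>v (x - y)"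
  proof (rule mat_exp_mult_eigenvector[OF A])
    have "A *\<^sub>v (x - y) = A *\<^sub>v x - A *\<^sub>v y"
      using A x y by (rule mult_minus_distrib_mat_vec)
    then show "A *\<^sub>v (x - y) = (\<alpha> - \<beta>) \<cdot>\<^sub>v (x - y)"
      unfolding Ax Ay using x y by (intro eq_vecI) (auto simp: algebra_simps)
  qed (use x y in auto)
  have "x = (1/2) \<cdot>\<^sub>v ((x + y) + (x - y))"
    using x y by (intro eq_vecI) auto
  then have "mat_exp A *\<^sub>v x = mat_exp A *\<^sub>v ((1/2) \<cdot>\<^sub>v ((x + y) + (x - y)))"
    by simp
  also have "\<dots> = (1/2) \<cdot>\<^sub>v (mat_exp A *\<^sub>v (x + y) + mat_exp A *\<^sub>v (x - y))"
    using A x y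
    by (subst mult_mat_vec[of _ n n])
       (auto intro!: arg_cong[of _ _ "\<lambda>v. (1/2) \<cdot>\<^sub>v v"] mult_add_distrib_mat_vec[of _ n n]
         simp del: assoc_add_vec)
  also have "\<dots> = exp \<alpha> \<cdot>\<^sub>v (cosh \<beta> \<cdot>\<^sub>v x + sinh \<beta> \<cdot>\<^sub>v y)"
    unfolding sum diff using x y
    by (intro eq_vecI)
       (auto simp: cosh_def sinh_def exp_add exp_diff exp_minus scaleR_conv_of_real field_simps)
  finally show ?thesis .
qed

section \<open>Transfer between pair states in an invariant plane\<close>

lemma not_lin_dep_pair_states:
  fixes c :: complex
  assumes lt: "a < n" "b < n" "a' < n" "b' < n" and dist: "distinct [a, b, a', b']" and c: "c \<noteq> 0"
  defines "x \<equiv> c \<cdot>\<^sub>v (unit_vec n a - unit_vec n b)"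
    and "y \<equiv> c \<cdot>\<^sub>v (unit_vec n a' - unit_vec n b')"
  shows "x \<noteq> y \<and> \<not> module.lin_dep class_ring (module_vec TYPE(complex) n) {x, y}"
proof
  interpret vec_space "TYPE(complex)" n .
  have x: "x $ a = c" "x $ a' = 0" and y: "y $ a = 0" "y $ a' = c"
    using lt dist by (auto simp: x_def y_def)
  then show "x \<noteq> y" using c by auto
  have carr: "{x, y} \<subseteq> carrier_vec n" by (auto simp: x_def y_def)
  show "\<not> lin_dep {x, y}"
  proof (rule finite_lin_indpt2)
    fix f assume zero: "lincomb f {x, y} = 0\<^sub>v n"
    have "f x * x $ i + f y * y $ i = 0" if "i < n" for i
      using lincomb_index[OF that carr, of f] zero that \<open>x \<noteq> y\<close> by simp
    from this[OF lt(1)] this[OF lt(3)] show "\<forall>v\<in>{x, y}. f v = 0"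
      using c x y by simp
  qed (use carr in auto)
qed

text \<open>
  In imaginary time \<open>cosh\<close> and \<open>sinh\<close> turn into \<open>cos\<close> and \<open>sin\<close>: the amplitude
  that stays at \<open>x\<close> is $\cos(\tau\beta)$. It first vanishes after a quarter period
  $\tau = \pi / (2 |\beta|)$, when everything has moved to \<open>y\<close>.
\<close>

lemma perfect_pair_state_transferI:
  fixes L :: "real mat"
  assumes L: "L \<in> carrier_mat n n"
    and lt: "a < n" "b < n" "a' < n" "b' < n" and dist: "distinct [a, b, a', b']"
    and x: "x = unit_vec n a - unit_vec n b" and y: "y = unit_vec n a' - unit_vec n b'"
    and Lx: "L *\<^sub>v x = \<alpha> \<cdot>\<^sub>v x + \<beta> \<cdot>\<^sub>v y" and Ly: "L *\<^sub>v y = \<alpha> \<cdot>\<^sub>v y + \<beta> \<cdot>\<^sub>v x"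
    and \<beta>: "\<beta> \<noteq> 0"
  shows "perfect_pair_state_transfer n L"
proof -
  define c where "c = complex_of_real (1 / sqrt 2)"
  define \<tau> where "\<tau> = pi / (2 * \<bar>\<beta>\<bar>)"
  let ?t = "\<i> * complex_of_real \<tau>"
  let ?C = "map_mat complex_of_real L"
  define X :: "complex vec" where "X = unit_vec n a - unit_vec n b"
  define Y :: "complex vec" where "Y = unit_vec n a' - unit_vec n b'"
  interpret of_real_hom: semiring_hom complex_of_real
    by unfold_locales auto
  have X: "X = map_vec complex_of_real x" and Y: "Y = map_vec complex_of_real y"
    using lt by (auto simp: X_def Y_def x y unit_vec_def intro!: eq_vecI)
  have carr: "x \<in> carrier_vec n" "y \<in> carrier_vec n" "X \<in> carrier_vec n" "Y \<in> carrier_vec n"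
    by (auto simp: x y X_def Y_def)
  have CX: "?C *\<^sub>v X = complex_of_real \<alpha> \<cdot>\<^sub>v X + complex_of_real \<beta> \<cdot>\<^sub>v Y"
    unfolding X Y of_real_hom.mult_mat_vec_hom[OF L carr(1), symmetric] Lx
    using carr by (intro eq_vecI) auto
  have CY: "?C *\<^sub>v Y = complex_of_real \<alpha> \<cdot>\<^sub>v Y + complex_of_real \<beta> \<cdot>\<^sub>v X"
    unfolding X Y of_real_hom.mult_mat_vec_hom[OF L carr(2), symmetric] Ly
    using carr by (intro eq_vecI) auto
  have C: "?C \<in> carrier_mat n n" using L by simp
  have A: "(?t \<cdot>\<^sub>m ?C) *\<^sub>v v = ?t \<cdot>\<^sub>v (?C *\<^sub>v v)" if "v \<in> carrier_vec n" for v
    using C that by (intro eq_vecI) (auto simp: scalar_prod_def sum_distrib_left mult_ac)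
  have scaled: "(?t \<cdot>\<^sub>m ?C) *\<^sub>v (c \<cdot>\<^sub>v v)
      = (?t * complex_of_real \<alpha>) \<cdot>\<^sub>v (c \<cdot>\<^sub>v v) + (?t * complex_of_real \<beta>) \<cdot>\<^sub>v (c \<cdot>\<^sub>v w)"
    if "?C *\<^sub>v v = complex_of_real \<alpha> \<cdot>\<^sub>v v + complex_of_real \<beta> \<cdot>\<^sub>v w"
      "v \<in> carrier_vec n" "w \<in> carrier_vec n" for v w
  proof -
    have "(?t \<cdot>\<^sub>m ?C) *\<^sub>v (c \<cdot>\<^sub>v v) = c \<cdot>\<^sub>v (?t \<cdot>\<^sub>v (?C *\<^sub>v v))"
      using C that(2) by (simp add: A[symmetric] mult_mat_vec[of _ n n])
    then show ?thesis
      unfolding that(1) using that(2,3) by (intro eq_vecI) (auto simp: algebra_simps)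
  qed
  have "exp (?t * complex_of_real \<beta>) = \<i> * complex_of_real (sgn \<beta>)"
  proof -
    have "\<tau> * \<beta> = sgn \<beta> * (pi / 2)"
      using \<beta> by (simp add: \<tau>_def sgn_if)
    then have "?t * complex_of_real \<beta> = \<i> * complex_of_real (sgn \<beta> * (pi / 2))"
      by (metis mult.assoc of_real_mult)
    then have "exp (?t * complex_of_real \<beta>) = cis (sgn \<beta> * (pi / 2))"
      by (simp only: cis_conv_exp)
    then show ?thesis
      using \<beta> by (auto simp: sgn_if complex_eq_iff)
  qed
  then have cosh0: "cosh (?t * complex_of_real \<beta>) = 0"
    using \<beta> by (auto simp: cosh_def exp_minus sgn_if)
  have "mat_exp (?t \<cdot>\<^sub>m ?C) *\<^sub>v (c \<cdot>\<^sub>v X)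
      = exp (?t * complex_of_real \<alpha>) \<cdot>\<^sub>v (cosh (?t * complex_of_real \<beta>) \<cdot>\<^sub>v (c \<cdot>\<^sub>v X)
          + sinh (?t * complex_of_real \<beta>) \<cdot>\<^sub>v (c \<cdot>\<^sub>v Y))"
    using C carr
    by (intro mat_exp_mult_swapped_pair[of _ n] scaled CX CY) auto
  also have "\<dots> = (exp (?t * complex_of_real \<alpha>) * sinh (?t * complex_of_real \<beta>)) \<cdot>\<^sub>v (c \<cdot>\<^sub>v Y)"
    unfolding cosh0 using carr by (intro eq_vecI) auto
  finally have transfer: "mat_exp (?t \<cdot>\<^sub>m ?C) *\<^sub>v (c \<cdot>\<^sub>v X) = \<dots>" .
  have "\<tau> > 0" using \<beta> by (simp add: \<tau>_def)
  have "c \<noteq> 0" by (simp add: c_def)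
  have "pair_state n (c \<cdot>\<^sub>v X)" "pair_state n (c \<cdot>\<^sub>v Y)"
    using lt dist unfolding pair_state_def c_def X_def Y_def by auto
  moreover have "c \<cdot>\<^sub>v X \<noteq> c \<cdot>\<^sub>v Y
      \<and> \<not> module.lin_dep class_ring (module_vec TYPE(complex) n) {c \<cdot>\<^sub>v X, c \<cdot>\<^sub>v Y}"
    unfolding X_def Y_def by (rule not_lin_dep_pair_states[OF lt dist \<open>c \<noteq> 0\<close>])
  ultimately show ?thesis
    unfolding perfect_pair_state_transfer_def using transfer \<open>\<tau> > 0\<close> by blast
qed

section \<open>Stars with two long legs\<close>

text \<open>
  The centre is 0 and the legs are $0, 1, 3$ and $0, 2, 4$; every vertex from 5 on is a leaf at the
  centre.
\<close>

definition two_legged_star :: "nat \<Rightarrow> nat pair_pre_digraph" where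
  "two_legged_star n = parent_tree n (\<lambda>v. if v = 3 then 1 else if v = 4 then 2 else 0)"

definition feet_potential :: "nat \<Rightarrow> real" where
  "feet_potential v = (if v \<in> {3, 4} then 1 else 0)"

lemma in_parcs_two_legged_star:
  "(u, v) \<in> parcs (two_legged_star n) \<longleftrightarrow> u < n \<and> v < n \<and>
     (0 < u \<and> v = (if u = 3 then 1 else if u = 4 then 2 else 0) \<or>
      0 < v \<and> u = (if v = 3 then 1 else if v = 4 then 2 else 0))"
  by (simp add: two_legged_star_def)

lemma tree_on_two_legged_star: "n > 0 \<Longrightarrow> tree_on n (two_legged_star n)"
  unfolding two_legged_star_def by (rule tree_on_parent_tree) auto

lemma out_degree_two_legged_star:
  assumes "n \<ge> 5"
  shows "out_degree (with_proj (two_legged_star n)) 1 = 2"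
    and "out_degree (with_proj (two_legged_star n)) 2 = 2"
    and "out_degree (with_proj (two_legged_star n)) 3 = 1"
    and "out_degree (with_proj (two_legged_star n)) 4 = 1"
proof -
  have deg: "out_degree (with_proj G) u = card {v. (u, v) \<in> parcs G}"
    for G :: "nat pair_pre_digraph" and u
  proof -
    have "out_arcs (with_proj G) u = Pair u ` {v. (u, v) \<in> parcs G}"
      by (auto simp: out_arcs_def)
    then show ?thesis
      by (simp add: out_degree_def card_image inj_on_def)
  qed
  have "{v. (1, v) \<in> parcs (two_legged_star n)} = {0, 3}"
    "{v. (2, v) \<in> parcs (two_legged_star n)} = {0, 4}"
    "{v. (3, v) \<in> parcs (two_legged_star n)} = {1}"
    "{v. (4, v) \<in> parcs (two_legged_star n)} = {2}"
    using assms by (auto simp: in_parcs_two_legged_star split: if_splits)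
  then show "out_degree (with_proj (two_legged_star n)) 1 = 2"
    "out_degree (with_proj (two_legged_star n)) 2 = 2"
    "out_degree (with_proj (two_legged_star n)) 3 = 1"
    "out_degree (with_proj (two_legged_star n)) 4 = 1"
    unfolding deg by simp_all
qed

lemma q_laplacian_carrier [simp]: "q_laplacian q n G \<eta> \<in> carrier_mat n n"
  by (rule carrier_matI)
     (simp_all add: q_laplacian_def adjacency_mat_def degree_mat_def potential_mat_def)

lemma index_q_laplacian:
  assumes "i < n" "j < n"
  shows "q_laplacian q n G \<eta> $$ (i, j) =
    (if i = j then 1 - q\<^sup>2 + q\<^sup>2 * (real (out_degree (with_proj G) j) + \<eta> j) else 0)
      - (if (i, j) \<in> parcs G then q else 0)"
  using assms
  by (simp add: q_laplacian_def adjacency_mat_def degree_mat_def potential_mat_def)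

lemma index_mult_mat_vec_unit_vec_diff:
  fixes L :: "real mat"
  assumes "L \<in> carrier_mat n n" "i < n" "a < n" "b < n"
  shows "(L *\<^sub>v (unit_vec n a - unit_vec n b)) $ i = L $$ (i, a) - L $$ (i, b)"
  using assms by (simp add: scalar_prod_minus_distrib[of _ n] scalar_prod_right_unit)

text \<open>
  The diagonal entries of the $q$-Laplacian agree on the four leg vertices: inner vertices have
  degree 2 and potential 0, feet have degree 1 and potential 1, which gives $1 - q^2 + 2 q^2$ in
  both cases. The leaves at the centre do not enter, because the entries $-q$ at the centre
  for the two inner vertices cancel.
\<close>

lemma perfect_pair_state_transfer_two_legged_star:
  assumes q: "q \<noteq> 0" and n: "n \<ge> 5"
  shows "perfect_pair_state_transfer n (q_laplacian q n (two_legged_star n) feet_potential)"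
proof (rule perfect_pair_state_transferI)
  let ?L = "q_laplacian q n (two_legged_star n) feet_potential"
  let ?x = "unit_vec n 1 - unit_vec n 2 :: real vec"
  let ?y = "unit_vec n 3 - unit_vec n 4 :: real vec"
  note deg = out_degree_two_legged_star[OF n]
  show "?L *\<^sub>v ?x = (1 + q\<^sup>2) \<cdot>\<^sub>v ?x + (- q) \<cdot>\<^sub>v ?y"
  proof (rule eq_vecI)
    fix i assume "i < dim_vec ((1 + q\<^sup>2) \<cdot>\<^sub>v ?x + (- q) \<cdot>\<^sub>v ?y)"
    then have i: "i < n" by simp
    have "(?L *\<^sub>v ?x) $ i = ?L $$ (i, 1) - ?L $$ (i, 2)"
      using i n by (intro index_mult_mat_vec_unit_vec_diff) auto
    also have "\<dots> = ((1 + q\<^sup>2) \<cdot>\<^sub>v ?x + (- q) \<cdot>\<^sub>v ?y) $ i"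
      using i n
      by (subst (1 2) index_q_laplacian) (auto simp: deg[simplified] feet_potential_def in_parcs_two_legged_star)
    finally show "(?L *\<^sub>v ?x) $ i = ((1 + q\<^sup>2) \<cdot>\<^sub>v ?x + (- q) \<cdot>\<^sub>v ?y) $ i" .
  qed (simp add: carrier_matD[OF q_laplacian_carrier])
  show "?L *\<^sub>v ?y = (1 + q\<^sup>2) \<cdot>\<^sub>v ?y + (- q) \<cdot>\<^sub>v ?x"
  proof (rule eq_vecI)
    fix i assume "i < dim_vec ((1 + q\<^sup>2) \<cdot>\<^sub>v ?y + (- q) \<cdot>\<^sub>v ?x)"
    then have i: "i < n" by simp
    have "(?L *\<^sub>v ?y) $ i = ?L $$ (i, 3) - ?L $$ (i, 4)"
      using i n by (intro index_mult_mat_vec_unit_vec_diff) auto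
    also have "\<dots> = ((1 + q\<^sup>2) \<cdot>\<^sub>v ?y + (- q) \<cdot>\<^sub>v ?x) $ i"
      using i n
      by (subst (1 2) index_q_laplacian) (auto simp: deg[simplified] feet_potential_def in_parcs_two_legged_star)
    finally show "(?L *\<^sub>v ?y) $ i = ((1 + q\<^sup>2) \<cdot>\<^sub>v ?y + (- q) \<cdot>\<^sub>v ?x) $ i" .
  qed (simp add: carrier_matD[OF q_laplacian_carrier])
qed (use assms in auto)

lemma card_verts_digraph_iso:
  assumes "digraph_iso G H"
  shows "card (verts G) = card (verts H)"
  using assms
  by (auto simp: digraph_iso_def verts_app_iso pre_digraph.digraph_isomorphism_def
      card_image)

theorem theorem12:
  fixes q :: real
  assumes "q \<noteq> 0"
  shows "\<exists>\<T> :: nat pair_pre_digraph set.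
           infinite \<T> \<and>
           pairwise (\<lambda>T T'. \<not> digraph_iso (with_proj T) (with_proj T')) \<T> \<and>
           (\<forall>T\<in>\<T>. \<exists>n. tree_on n T \<and>
              (\<exists>\<eta> :: nat \<Rightarrow> real. card {v \<in> pverts T. \<eta> v \<noteq> 0} = 2 \<and>
                 perfect_pair_state_transfer n (q_laplacian q n T \<eta>)))"
proof (rule exI[of _ "two_legged_star ` {5..}"], intro conjI ballI)
  let ?T = "two_legged_star ` {5..}"
  have card: "card (pverts (two_legged_star n)) = n" for n
    by (simp add: two_legged_star_def)
  have "inj two_legged_star"
    by (metis card injI)
  then show "infinite ?T"
    by (simp add: finite_image_iff inj_on_subset infinite_Ici)
  show "pairwise (\<lambda>T T'. \<not> digraph_iso (with_proj T) (with_proj T')) ?T"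
    using card_verts_digraph_iso[of "with_proj (two_legged_star _)" "with_proj (two_legged_star _)"]
    by (auto simp: pairwise_def card)
  fix T assume "T \<in> ?T"
  then obtain n where n: "n \<ge> 5" and T: "T = two_legged_star n" by auto
  have "{v \<in> pverts T. feet_potential v \<noteq> 0} = {3, 4}"
    using n by (auto simp: T two_legged_star_def feet_potential_def)
  then show "\<exists>n. tree_on n T \<and>
              (\<exists>\<eta> :: nat \<Rightarrow> real. card {v \<in> pverts T. \<eta> v \<noteq> 0} = 2 \<and>
                 perfect_pair_state_transfer n (q_laplacian q n T \<eta>))"
    using n assms tree_on_two_legged_star[of n] perfect_pair_state_transfer_two_legged_star[of q n]
    by (intro exI[of _ n] conjI exI[of _ feet_potential]) (auto simp: T)
qed

end
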